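(* Let $f(X)=a_0+a_1X+\cdots+a_nX^n$ be a polynomial with integer coefficients, and $a,b$ two integers such that $a^2<b^2$ and $|a_n|>\sum_{i=0}^{n-1}|a_i|\left(\frac{|a+b|}{2}\right)^{i-n}$. Then $f$ is irreducible over $\mathbb{Q}$ in each of the following four cases: (i) $|f(a)|=p^{k_1}r$, $|f(b)|=p^{k_2}$ for some prime number $p$ and some integers $k_1,k_2,r$ with $0\le k_1<k_2$, $0<r<p$, $p\nmid f'(a)f'(b)$ and $r\nmid f'(a)$; (ii) $|f(a)|=p^k$, $|f(b)|=p^kr^j$ for two distinct prime numbers $p,r$ and some positive integers $k,j$ with $p^k>r^j$, $p\nmid f'(a)f'(b)$ and $r\nmid f'(b)$; (iii) $|f(a)|=p^u$, $|f(b)|=q^vr^t$ for three distinct prime numbers $p,q,r$ and some positive integers $u,v,t$ with $p^u>q^v$, $p^u>r^t$, $p^u<q^vr^t$, $p\nmid f'(a)$, $q\nmid f'(b)$ and $r\nmid f'(b)$; (iv) $|f(a)|=p^uq^v$, $|f(b)|=r^ks^l$ for four distinct prime numbers $p,q,r,s$ and some positive integers $u,v,k,l$ with $p^u>r^k>s^l>q^v$, $p^uq^v<r^ks^l$, $p\nmid f'(a)$, $q\nmid f'(a)$, $r\nmid f'(b)$ and $s\nmid f'(b)$.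
   Context: $f'$ denotes the derivative of $f$. *)

theory Defs
  imports Complex_Main "HOL-Computational_Algebra.Computational_Algebra"
begin

end

theory Submission
  imports Defs
begin

text \<open>
  The dominance hypothesis confines the complex roots of \<open>f\<close> to the open disc of
  radius \<open>\<bar>a + b\<bar> / 2\<close> around 0, hence to the half-plane of points closer to \<open>a\<close> than to \<open>b\<close>.
  So every nonconstant integral factor \<open>g\<close> of \<open>f\<close> satisfies \<open>\<bar>g(a)\<bar> < \<bar>g(b)\<bar>\<close>. For a
  nontrivial factorisation \<open>f = g h\<close>, a prime not dividing \<open>f'(x)\<close> cannot divide both \<open>g(x)\<close> and
  \<open>h(x)\<close>, so each prime power in \<open>f(x)\<close> goes entirely to one factor. As \<open>g(b)\<close> and \<open>h(b)\<close> cannot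
  be units (else \<open>g(a) = 0\<close> or \<open>h(a) = 0\<close>), \<open>f(b)\<close> is not a prime power, which settles case (i);
  otherwise \<open>g(b)\<close> and \<open>h(b)\<close> are, up to sign, the two prime powers in \<open>f(b)\<close>, while one
  of \<open>\<bar>g(a)\<bar>\<close>, \<open>\<bar>h(a)\<bar>\<close> is at least the power of \<open>p\<close> in \<open>f(a)\<close>, which is no smaller than either of them.
\<close>

section \<open>Gauss's lemma for integer polynomials\<close>

abbreviation (input) of_int_poly :: "int poly \<Rightarrow> 'a::comm_ring_1 poly" where
  "of_int_poly \<equiv> map_poly of_int"

lemma of_int_poly_mult: "of_int_poly (p * q) = of_int_poly p * of_int_poly q"
  by (simp add: poly_eq_iff coeff_map_poly coeff_mult)

lemma of_int_poly_smult: "of_int_poly (smult k p) = smult (of_int k) (of_int_poly p)"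
  by (simp add: poly_eq_iff coeff_map_poly)

lemma poly_of_int_poly: "poly (of_int_poly p) (of_int x) = of_int (poly p x)"
  by (induction p) (simp_all add: map_poly_pCons)

lemma clear_denominators:
  fixes g :: "rat poly"
  obtains d :: int and G :: "int poly" where "d > 0" "smult (of_int d) g = of_int_poly G"
proof -
  have "\<exists>(d::int) G. d > 0 \<and> smult (of_int d) g = of_int_poly G"
  proof (induction g)
    case 0
    show ?case by (intro exI[of _ "1::int"] exI[of _ "0::int poly"]) simp
  next
    case (pCons x g)
    then obtain d G where d: "d > 0" "smult (of_int d) g = of_int_poly G"
      by blast
    obtain m e where "quotient_of x = (m, e)" by force
    then have e: "e > 0" and x: "x = of_int m / of_int e"
      by (simp_all add: quotient_of_denom_pos quotient_of_div)
    have "smult (of_int (d * e)) g = smult (of_int e) (smult (of_int d) g)"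
      by (simp add: mult.commute)
    also have "\<dots> = of_int_poly (smult e G)"
      by (simp add: d(2) of_int_poly_smult)
    finally have "smult (of_int (d * e)) (pCons x g) = of_int_poly (pCons (d * m) (smult e G))"
      using e x by (simp add: map_poly_pCons)
    then show ?case using d(1) e by (metis mult_pos_pos)
  qed
  then show thesis using that by blast
qed

text \<open>Gauss's lemma: clearing denominators in a rational factorisation gives
  \<open>G * H = smult (d * e) f\<close>, and contents are multiplicative, so passing to primitive
  parts removes \<open>d * e\<close> without changing degrees. Integer constant factors are units
  over the rationals, so \<open>f\<close> need not be primitive.\<close>

lemma irreducible_of_int_polyI:
  fixes f :: "int poly"
  assumes deg: "degree f > 0"
    and irred: "\<And>g h. f = g * h \<Longrightarrow> degree g > 0 \<Longrightarrow> degree h > 0 \<Longrightarrow> False"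
  shows "irreducible (map_poly rat_of_int f)"
proof (rule irreducibleI)
  have degf: "degree (map_poly rat_of_int f) = degree f"
    by (simp add: degree_map_poly)
  show "map_poly rat_of_int f \<noteq> 0" using deg degf by force
  show "\<not> map_poly rat_of_int f dvd 1"
    using deg degf by (metis is_unit_iff_degree degree_0 less_irrefl)
  fix g h :: "rat poly"
  assume fgh: "map_poly rat_of_int f = g * h"
  obtain d G where d: "d > 0" "smult (of_int d) g = of_int_poly G"
    by (rule clear_denominators)
  obtain e H where e: "e > 0" "smult (of_int e) h = of_int_poly H"
    by (rule clear_denominators)
  have "of_int_poly (G * H) = smult (of_int d) g * smult (of_int e) h"
    by (simp add: d e of_int_poly_mult)
  also have "\<dots> = of_int_poly (smult (d * e) f)"
    by (simp add: fgh [symmetric] mult.commute poly_eq_iff coeff_map_poly)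
  finally have GH: "G * H = smult (d * e) f"
    by (simp add: poly_eq_iff coeff_map_poly flip: of_int_mult)
  then have cont: "content G * content H = d * e * content f"
    using d(1) e(1) by (metis content_mult content_smult abs_of_pos mult_pos_pos normalize_int_def)
  have "smult (d * e) f = smult (content G * content H) (primitive_part G * primitive_part H)"
    by (metis GH content_times_primitive_part mult_smult_left mult_smult_right smult_smult)
  also have "\<dots> = smult (d * e) (smult (content f) (primitive_part G) * primitive_part H)"
    by (simp add: cont)
  \<comment> \<open>The nonzero factor \<open>d * e\<close> cancels; the content of \<open>f\<close>
    is attached to the first factor so that the identity is exact over the integers.\<close>
  finally have f: "f = smult (content f) (primitive_part G) * primitive_part H"
    using d(1) e(1) by (simp add: poly_eq_iff)
  have "degree (primitive_part G) = degree g" "degree (primitive_part H) = degree h"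
    using d e by (metis degree_map_poly degree_primitive_part degree_smult_eq of_int_0_eq_iff order_less_irrefl)+
  moreover have "content f \<noteq> 0" using deg by auto
  ultimately have "degree g = 0 \<or> degree h = 0"
    using irred [OF f] by auto
  moreover have "g \<noteq> 0" "h \<noteq> 0" using fgh deg degf by auto
  ultimately show "g dvd 1 \<or> h dvd 1" by (simp add: is_unit_iff_degree)
qed

section \<open>Complex roots and growth from \<open>a\<close> to \<open>b\<close>\<close>

text \<open>If \<open>norm z \<ge> M\<close>, each \<open>norm z ^ i\<close> with
  \<open>i < n\<close> is at most \<open>M powi (i - n) * norm z ^ n\<close>. The lower terms
  together are then smaller in norm than the term of index \<open>n\<close> and cannot cancel
  it.\<close>

lemma dominant_coeff_root_bound:
  fixes p :: "complex poly" and M :: real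
  assumes M: "M > 0"
    and dominant: "norm (coeff p n) > (\<Sum>i<n. norm (coeff p i) * M powi (int i - int n))"
    and deg: "degree p \<le> n" and root: "poly p z = 0"
  shows "norm z < M"
proof (rule ccontr)
  assume "\<not> norm z < M"
  then have z: "norm z \<ge> M" "norm z > 0" using M by linarith+
  have "0 = (\<Sum>i\<le>n. coeff p i * z ^ i)"
    using root deg by (subst root [symmetric], unfold poly_altdef)
      (intro sum.mono_neutral_left, auto simp: coeff_eq_0)
  also have "\<dots> = coeff p n * z ^ n + (\<Sum>i<n. coeff p i * z ^ i)"
    by (simp flip: lessThan_Suc_atMost)
  finally have "norm (coeff p n * z ^ n) = norm (\<Sum>i<n. coeff p i * z ^ i)"
    by (metis add_eq_0_iff norm_minus_cancel)
  also have "\<dots> \<le> (\<Sum>i<n. norm (coeff p i * z ^ i))"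
    by (rule norm_sum)
  also have "\<dots> = (\<Sum>i<n. norm (coeff p i) * norm z ^ i)"
    by (simp add: norm_mult norm_power)
  also have "\<dots> \<le> (\<Sum>i<n. norm (coeff p i) * M powi (int i - int n) * norm z ^ n)"
  proof (rule sum_mono)
    fix i assume "i \<in> {..<n}"
    then have i: "i < n" by simp
    have "1 \<le> (norm z / M) ^ (n - i)"
      using z M by (intro one_le_power) simp
    then have "norm z ^ i \<le> norm z ^ i * (norm z / M) ^ (n - i)"
      by (simp add: mult_le_cancel_left1)
    also have "\<dots> = norm z ^ i * norm z ^ (n - i) * inverse (M ^ (n - i))"
      by (simp add: divide_inverse power_mult_distrib power_inverse)
    also have "norm z ^ i * norm z ^ (n - i) = norm z ^ n"
      using i by (simp flip: power_add)
    also have "inverse (M ^ (n - i)) = M powi (int i - int n)"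
      using i by (simp add: power_int_def power_inverse nat_diff_distrib)
    finally have "norm (coeff p i) * norm z ^ i
        \<le> norm (coeff p i) * (norm z ^ n * M powi (int i - int n))"
      by (rule mult_left_mono) simp
    then show "norm (coeff p i) * norm z ^ i
        \<le> norm (coeff p i) * M powi (int i - int n) * norm z ^ n"
      by (simp add: mult_ac)
  qed
  also have "\<dots> = (\<Sum>i<n. norm (coeff p i) * M powi (int i - int n)) * norm z ^ n"
    by (simp add: sum_distrib_right)
  also have "\<dots> < norm (coeff p n) * norm z ^ n"
    using dominant z by (intro mult_strict_right_mono) auto
  finally show False by (simp add: norm_mult norm_power)
qed

text \<open>The difference of the squared distances is \<open>(b - a) * (a + b - 2 * Re z)\<close>.
  Since \<open>(b - a) * (a + b)\<close> is positive, it suffices that \<open>2 * Re z\<close> is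
  smaller than \<open>a + b\<close> in absolute value.\<close>

lemma norm_of_real_diff_less:
  fixes a b :: real and z :: complex
  assumes ab: "a ^ 2 < b ^ 2" and z: "norm z < \<bar>a + b\<bar> / 2"
  shows "norm (of_real a - z) < norm (of_real b - z)"
proof -
  have pos: "(b - a) * (a + b) > 0"
    using ab by (simp add: algebra_simps power2_eq_square)
  have "\<bar>2 * Re z\<bar> < \<bar>a + b\<bar>"
    using z abs_Re_le_cmod [of z] by (simp add: abs_mult)
  then have "\<bar>b - a\<bar> * \<bar>2 * Re z\<bar> < \<bar>b - a\<bar> * \<bar>a + b\<bar>"
    using pos by (intro mult_strict_left_mono) auto
  then have "(b - a) * (2 * Re z) < (b - a) * (a + b)"
    using pos by (simp flip: abs_mult)
  then have "(a - Re z) ^ 2 < (b - Re z) ^ 2"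
    by (simp add: algebra_simps power2_eq_square)
  then show ?thesis by (simp add: cmod_def)
qed

text \<open>Over the complex numbers \<open>p\<close> is a constant times linear factors, each of
  smaller norm at \<open>x\<close> than at \<open>y\<close>; the induction splits off one root at a
  time.\<close>

lemma norm_poly_less:
  fixes p :: "complex poly"
  assumes "degree p > 0"
    and "\<And>z. poly p z = 0 \<Longrightarrow> norm (x - z) < norm (y - z)"
  shows "norm (poly p x) < norm (poly p y)"
  using assms
proof (induction "degree p" arbitrary: p rule: less_induct)
  case less
  have "\<not> constant (poly p)"
    using less.prems(1) by (simp add: constant_degree)
  then obtain z where z: "poly p z = 0"
    using fundamental_theorem_of_algebra by blast
  then obtain q where p: "p = [:-z, 1:] * q"
    by (metis poly_eq_0_iff_dvd dvdE)
  have "q \<noteq> 0" using less.prems(1) p by auto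
  then have deg: "degree p = Suc (degree q)"
    unfolding p by (subst degree_mult_eq) auto
  have xy: "norm (x - z) < norm (y - z)"
    using less.prems(2) z by blast
  \<comment> \<open>The cofactor \<open>q\<close> may be constant, so only a weak inequality is
    available; strictness comes from the factor at \<open>z\<close>, and positivity at
    \<open>y\<close> preserves it under multiplication.\<close>
  have "norm (poly q x) \<le> norm (poly q y) \<and> norm (poly q y) > 0"
  proof (cases "degree q = 0")
    case True
    then show ?thesis using \<open>q \<noteq> 0\<close> by (auto elim!: degree_eq_zeroE)
  next
    case False
    have "norm (poly q x) < norm (poly q y)"
    proof (rule less.hyps)
      show "norm (x - w) < norm (y - w)" if "poly q w = 0" for w
        using that less.prems(2) by (simp add: p)
    qed (use deg False in auto)
    then show ?thesis
      by (meson less_le_trans less_imp_le norm_ge_zero not_le)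
  qed
  then have "norm (x - z) * norm (poly q x) < norm (y - z) * norm (poly q y)"
    using xy by (meson le_less_trans mult_left_mono mult_strict_right_mono norm_ge_zero)
  then show ?case by (simp add: p flip: norm_mult) (simp add: algebra_simps)
qed

section \<open>Distribution of prime powers between two factors\<close>

text \<open>By the product rule, a prime dividing both \<open>poly g x\<close> and
  \<open>poly h x\<close> would divide the derivative of \<open>f\<close> at \<open>x\<close>. Hence
  \<open>p ^ k\<close> is coprime to one of the two values and divides the other.\<close>

lemma prime_power_dvd_factor:
  fixes f g h :: "int poly" and p x :: int
  assumes fgh: "f = g * h" and p: "prime p" and "\<not> p dvd poly (pderiv f) x"
    and "p ^ k dvd poly f x"
  shows "p ^ k dvd poly g x \<or> p ^ k dvd poly h x"
proof -
  have "\<not> (p dvd poly g x \<and> p dvd poly h x)"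
    using assms(3) by (auto simp: fgh pderiv_mult)
  then have "coprime (p ^ k) (poly g x) \<or> coprime (p ^ k) (poly h x)"
    using p by (metis prime_imp_coprime coprime_power_left_iff)
  then show ?thesis
    using assms(4) by (auto simp: fgh coprime_dvd_mult_right_iff coprime_dvd_mult_left_iff)
qed

text \<open>If one value absorbed both \<open>Q\<close> and \<open>R\<close>, the other would be a
  unit. So they go to different values, and the remaining cofactors are units.\<close>

lemma coprime_factor_values:
  fixes x y Q R :: int
  assumes xy: "\<bar>x * y\<bar> = Q * R" and QR: "coprime Q R" "Q > 0" "R > 0"
    and "Q dvd x \<or> Q dvd y" "R dvd x \<or> R dvd y"
    and ne: "\<bar>x\<bar> \<noteq> 1" "\<bar>y\<bar> \<noteq> 1"
  shows "(\<bar>x\<bar> = Q \<and> \<bar>y\<bar> = R) \<or> (\<bar>x\<bar> = R \<and> \<bar>y\<bar> = Q)"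
proof -
  have both: False if "Q dvd u" "R dvd u" "\<bar>u * v\<bar> = Q * R" "\<bar>v\<bar> \<noteq> 1" for u v :: int
  proof -
    have "Q * R dvd u" using that QR by (simp add: divides_mult)
    then obtain t where "u = Q * R * t" by blast
    then have "Q * R * \<bar>t * v\<bar> = Q * R * 1"
      using that(3) QR by (simp add: abs_mult)
    then have "\<bar>t * v\<bar> = 1" using QR by (metis mult_cancel_left mult_eq_0_iff less_irrefl)
    then show False using that(4) by (metis abs_zmult_eq_1 mult.commute)
  qed
  have split: "\<bar>u\<bar> = Q \<and> \<bar>v\<bar> = R" if "Q dvd u" "R dvd v" "\<bar>u * v\<bar> = Q * R" for u v :: int
  proof -
    obtain s t where st: "u = Q * s" "v = R * t" using \<open>Q dvd u\<close> \<open>R dvd v\<close> by blast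
    then have "Q * R * \<bar>s * t\<bar> = Q * R * 1"
      using that(3) QR by (simp add: abs_mult)
    then have "\<bar>s * t\<bar> = 1" using QR by (metis mult_cancel_left mult_eq_0_iff less_irrefl)
    then have "\<bar>s\<bar> = 1" "\<bar>t\<bar> = 1" by (metis abs_zmult_eq_1 mult.commute)+
    then show ?thesis using st QR by (simp add: abs_mult)
  qed
  show ?thesis
    using assms(5,6) both [of x y] both [of y x] split [of x y] split [of y x] xy ne
    by (auto simp: mult.commute)
qed

lemma factor_value_split:
  fixes f g h :: "int poly" and a b q r :: int
  assumes fgh: "f = g * h"
    and g: "\<bar>poly g a\<bar> < \<bar>poly g b\<bar>" and h: "\<bar>poly h a\<bar> < \<bar>poly h b\<bar>"
    and fa: "poly f a \<noteq> 0"
    and q: "prime q" "\<not> q dvd poly (pderiv f) b"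
    and r: "prime r" "\<not> r dvd poly (pderiv f) b"
    and "q \<noteq> r" and fb: "\<bar>poly f b\<bar> = q ^ v * r ^ t"
  shows "(\<bar>poly g b\<bar> = q ^ v \<and> \<bar>poly h b\<bar> = r ^ t) \<or> (\<bar>poly g b\<bar> = r ^ t \<and> \<bar>poly h b\<bar> = q ^ v)"
proof (rule coprime_factor_values)
  show "\<bar>poly g b * poly h b\<bar> = q ^ v * r ^ t" using fb by (simp add: fgh)
  show "coprime (q ^ v) (r ^ t)"
    using q(1) r(1) \<open>q \<noteq> r\<close> by (simp add: primes_coprime)
  show "q ^ v > 0" "r ^ t > 0" using q(1) r(1) by (simp_all add: prime_gt_0_int)
  have "q ^ v dvd poly f b" "r ^ t dvd poly f b"
    using fb by (metis dvd_abs_iff dvd_triv_left dvd_triv_right)+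
  then show "q ^ v dvd poly g b \<or> q ^ v dvd poly h b" "r ^ t dvd poly g b \<or> r ^ t dvd poly h b"
    using prime_power_dvd_factor [OF fgh] q r by blast+
  have "poly g a \<noteq> 0" "poly h a \<noteq> 0" using fa by (auto simp: fgh)
  then show "\<bar>poly g b\<bar> \<noteq> 1" "\<bar>poly h b\<bar> \<noteq> 1" using g h by linarith+
qed

text \<open>The factor whose value at \<open>a\<close> is divisible by \<open>p ^ u\<close> has
  absolute value at least \<open>p ^ u\<close> there, but at \<open>b\<close> only
  \<open>q ^ v\<close> or \<open>r ^ t\<close>, against the growth from \<open>a\<close> to
  \<open>b\<close>. The prime \<open>p\<close> may coincide with \<open>q\<close> or
  \<open>r\<close>.\<close>

lemma no_factorization:
  fixes f g h :: "int poly" and a b p q r :: int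
  assumes fgh: "f = g * h"
    and g: "\<bar>poly g a\<bar> < \<bar>poly g b\<bar>" and h: "\<bar>poly h a\<bar> < \<bar>poly h b\<bar>"
    and fa: "poly f a \<noteq> 0"
    and p: "prime p" "\<not> p dvd poly (pderiv f) a" "p ^ u dvd poly f a"
    and q: "prime q" "\<not> q dvd poly (pderiv f) b"
    and r: "prime r" "\<not> r dvd poly (pderiv f) b"
    and "q \<noteq> r" "\<bar>poly f b\<bar> = q ^ v * r ^ t" "q ^ v \<le> p ^ u" "r ^ t \<le> p ^ u"
  shows False
proof -
  have "poly g a \<noteq> 0" "poly h a \<noteq> 0" using fa by (auto simp: fgh)
  moreover have "p ^ u dvd poly g a \<or> p ^ u dvd poly h a"
    using prime_power_dvd_factor [OF fgh] p by blast
  ultimately have "p ^ u \<le> \<bar>poly g a\<bar> \<or> p ^ u \<le> \<bar>poly h a\<bar>"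
    by (auto dest: dvd_imp_le_int)
  moreover have "(\<bar>poly g b\<bar> = q ^ v \<and> \<bar>poly h b\<bar> = r ^ t) \<or> (\<bar>poly g b\<bar> = r ^ t \<and> \<bar>poly h b\<bar> = q ^ v)"
    using factor_value_split [OF fgh g h fa q r] assms by blast
  ultimately show False using g h assms by linarith
qed

section \<open>Irreducibility in the four arithmetic cases\<close>

theorem corollary3p3:
  fixes f :: "int poly" and c :: "nat \<Rightarrow> int" and n :: nat and a b :: int
  assumes f: "f = (\<Sum>i\<le>n. monom (c i) i)"
    and ab: "a ^ 2 < b ^ 2"
    and dominant: "real_of_int \<bar>c n\<bar>
        > (\<Sum>i<n. real_of_int \<bar>c i\<bar> * (real_of_int \<bar>a + b\<bar> / 2) powi (int i - int n))"
    and cases: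
      "(\<exists>(p::int) (k\<^sub>1::nat) (k\<^sub>2::nat) (r::int).
          prime p \<and> 0 \<le> k\<^sub>1 \<and> k\<^sub>1 < k\<^sub>2 \<and> 0 < r \<and> r < p \<and>
          \<bar>poly f a\<bar> = p ^ k\<^sub>1 * r \<and> \<bar>poly f b\<bar> = p ^ k\<^sub>2 \<and>
          \<not> p dvd poly (pderiv f) a * poly (pderiv f) b \<and>
          \<not> r dvd poly (pderiv f) a)
     \<or> (\<exists>(p::int) (r::int) (k::nat) (j::nat).
          prime p \<and> prime r \<and> p \<noteq> r \<and> 0 < k \<and> 0 < j \<and>
          \<bar>poly f a\<bar> = p ^ k \<and> \<bar>poly f b\<bar> = p ^ k * r ^ j \<and>
          p ^ k > r ^ j \<and>
          \<not> p dvd poly (pderiv f) a * poly (pderiv f) b \<and>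
          \<not> r dvd poly (pderiv f) b)
     \<or> (\<exists>(p::int) (q::int) (r::int) (u::nat) (v::nat) (t::nat).
          prime p \<and> prime q \<and> prime r \<and> distinct [p, q, r] \<and>
          0 < u \<and> 0 < v \<and> 0 < t \<and>
          \<bar>poly f a\<bar> = p ^ u \<and> \<bar>poly f b\<bar> = q ^ v * r ^ t \<and>
          p ^ u > q ^ v \<and> p ^ u > r ^ t \<and> p ^ u < q ^ v * r ^ t \<and>
          \<not> p dvd poly (pderiv f) a \<and>
          \<not> q dvd poly (pderiv f) b \<and> \<not> r dvd poly (pderiv f) b)
     \<or> (\<exists>(p::int) (q::int) (r::int) (s::int) (u::nat) (v::nat) (k::nat) (l::nat).
          prime p \<and> prime q \<and> prime r \<and> prime s \<and> distinct [p, q, r, s] \<and>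
          0 < u \<and> 0 < v \<and> 0 < k \<and> 0 < l \<and>
          \<bar>poly f a\<bar> = p ^ u * q ^ v \<and> \<bar>poly f b\<bar> = r ^ k * s ^ l \<and>
          p ^ u > r ^ k \<and> r ^ k > s ^ l \<and> s ^ l > q ^ v \<and>
          p ^ u * q ^ v < r ^ k * s ^ l \<and>
          \<not> p dvd poly (pderiv f) a \<and> \<not> q dvd poly (pderiv f) a \<and>
          \<not> r dvd poly (pderiv f) b \<and> \<not> s dvd poly (pderiv f) b)"
  shows "irreducible (map_poly rat_of_int f)"
proof (rule irreducible_of_int_polyI)
  have coeff_f: "coeff f i = (if i \<le> n then c i else 0)" for i
    by (simp add: f coeff_sum)
  have deg_le: "degree f \<le> n"
    by (rule degree_le) (simp add: coeff_f)
  have fa: "poly f a \<noteq> 0"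
    using cases by (elim disjE exE conjE) (auto simp: prime_gt_0_int)
  \<comment> \<open>In every case some prime fails to divide a value of the derivative, or a product
    of such values, so the derivative is not zero.\<close>
  have "pderiv f \<noteq> 0"
    using cases by (elim disjE exE conjE) auto
  then show "degree f > 0" by (auto simp: pderiv_eq_0_iff)
  fix g h :: "int poly"
  assume fgh: "f = g * h" and gh: "degree g > 0" "degree h > 0"
  have ab': "real_of_int a ^ 2 < real_of_int b ^ 2"
    using ab by (metis of_int_less_iff of_int_power)
  have "a + b \<noteq> 0"
    using ab by (auto simp: add_eq_0_iff)
  then have M: "real_of_int \<bar>a + b\<bar> / 2 > 0" by simp
  have root: "norm (of_int a - z) < norm (of_int b - z)"
    if "poly (of_int_poly f) z = 0" for z :: complex
  proof -
    have "norm z < real_of_int \<bar>a + b\<bar> / 2"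
    proof (rule dominant_coeff_root_bound [OF M _ _ that])
      show "degree (of_int_poly f :: complex poly) \<le> n"
        using deg_le by (simp add: degree_map_poly)
      show "norm (coeff (of_int_poly f :: complex poly) n) >
          (\<Sum>i<n. norm (coeff (of_int_poly f :: complex poly) i)
            * (real_of_int \<bar>a + b\<bar> / 2) powi (int i - int n))"
        using dominant by (simp add: coeff_map_poly coeff_f)
    qed
    then show ?thesis
      using norm_of_real_diff_less [OF ab', of z] by simp
  qed
  have less: "\<bar>poly k a\<bar> < \<bar>poly k b\<bar>" if "k dvd f" "degree k > 0" for k
  proof -
    have "norm (poly (of_int_poly k) (of_int a :: complex)) < norm (poly (of_int_poly k) (of_int b :: complex))"
    proof (rule norm_poly_less)
      fix z :: complex assume "poly (of_int_poly k) z = 0"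
      then have "poly (of_int_poly f) z = 0"
        using \<open>k dvd f\<close> by (auto simp: of_int_poly_mult)
      then show "norm (of_int a - z) < norm (of_int b - z)" by (rule root)
    qed (use that in \<open>simp add: degree_map_poly\<close>)
    then show ?thesis by (simp add: poly_of_int_poly flip: of_int_abs)
  qed
  have g: "\<bar>poly g a\<bar> < \<bar>poly g b\<bar>" and h: "\<bar>poly h a\<bar> < \<bar>poly h b\<bar>"
    using less gh fgh by auto
  note no = no_factorization [OF fgh g h fa]
  show False
    using cases
  proof (elim disjE exE conjE)
    fix p :: int and k\<^sub>2 :: nat
    assume p: "prime p" "\<not> p dvd poly (pderiv f) a * poly (pderiv f) b"
      and fb: "\<bar>poly f b\<bar> = p ^ k\<^sub>2"
    have "poly g a \<noteq> 0" "poly h a \<noteq> 0" using fa by (auto simp: fgh)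
    then have "\<bar>poly g b\<bar> \<noteq> 1" "\<bar>poly h b\<bar> \<noteq> 1" using g h by linarith+
    moreover have "p ^ k\<^sub>2 dvd poly g b \<or> p ^ k\<^sub>2 dvd poly h b"
      using prime_power_dvd_factor [OF fgh] p fb by (metis dvd_abs_iff dvd_mult dvd_refl)
    \<comment> \<open>Taking \<open>R = 1\<close> forces one of the two values at \<open>b\<close>
      to be a unit, which has just been excluded.\<close>
    ultimately show False
      using coprime_factor_values [of "poly g b" "poly h b" "p ^ k\<^sub>2" 1] fb p
      by (auto simp: fgh prime_gt_0_int)
  next
    fix p r :: int and k j :: nat
    assume "prime p" "prime r" "p \<noteq> r" "\<bar>poly f a\<bar> = p ^ k" "\<bar>poly f b\<bar> = p ^ k * r ^ j"
      "p ^ k > r ^ j" "\<not> p dvd poly (pderiv f) a * poly (pderiv f) b"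
      "\<not> r dvd poly (pderiv f) b"
    moreover from this have "p ^ k dvd poly f a" by (metis dvd_abs_iff dvd_refl)
    \<comment> \<open>Here \<open>p\<close> occurs at both points and also takes the role of
      \<open>q\<close>, so the bound \<open>q ^ v \<le> p ^ u\<close> holds with equality.\<close>
    ultimately show False
      by (intro no [of p k p r k j]) auto
  next
    fix p q r :: int and u v t :: nat
    assume "prime p" "prime q" "prime r" "distinct [p, q, r]"
      "\<bar>poly f a\<bar> = p ^ u" "\<bar>poly f b\<bar> = q ^ v * r ^ t" "p ^ u > q ^ v" "p ^ u > r ^ t"
      "\<not> p dvd poly (pderiv f) a" "\<not> q dvd poly (pderiv f) b" "\<not> r dvd poly (pderiv f) b"
    moreover from this have "p ^ u dvd poly f a" by (metis dvd_abs_iff dvd_refl)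
    ultimately show False
      by (intro no [of p u q r v t]) auto
  next
    fix p q r s :: int and u v k l :: nat
    assume "prime p" "prime r" "prime s" "distinct [p, q, r, s]"
      "\<bar>poly f a\<bar> = p ^ u * q ^ v" "\<bar>poly f b\<bar> = r ^ k * s ^ l" "p ^ u > r ^ k" "r ^ k > s ^ l"
      "\<not> p dvd poly (pderiv f) a" "\<not> r dvd poly (pderiv f) b" "\<not> s dvd poly (pderiv f) b"
    moreover from this have "p ^ u dvd poly f a" by (metis dvd_abs_iff dvd_triv_left)
    \<comment> \<open>The chain \<open>p ^ u > r ^ k > s ^ l\<close> makes \<open>p ^ u\<close>
      exceed both prime powers in the value at \<open>b\<close>.\<close>
    ultimately show False
      by (intro no [of p u r s k l]) auto
  qed
qed

end
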